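(* Let $R$ be an exchange ring. Then the following two statements are equivalent: (1) $R$ is a $W\Delta U$ ring. (2) $R$ is a $WUJ$ ring.
   Context: Rings are associative with identity, not necessarily commutative. $J(R)$ is the Jacobson radical and $U(R)$ the group of units of $R$. $\Delta(R)=\{r\in R : r+u\in U(R)\text{ for all }u\in U(R)\}$; equivalently $\Delta(R)=J(T)$, where $T$ is the subring of $R$ generated by $U(R)$. $R$ is $W\Delta U$ if $U(R)=\pm 1+\Delta(R)$, i.e. every unit of $R$ has the form $1+d$ or $-1+d$ with $d\in\Delta(R)$. $R$ is $WUJ$ (also called $WJU$) if $U(R)=\pm 1+J(R)$, i.e. every unit of $R$ has the form $1+j$ or $-1+j$ with $j\in J(R)$. $R$ is exchange if for every $a\in R$ there is an idempotent $e\in aR$ with $1-e\in(1-a)R$. *)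

theory Defs
  imports Main
begin

(* Rings are modelled by the sort {ring, monoid_mult}: associative, with identity, not
   necessarily commutative.  Compared with class ring_1, this sort omits only the axiom
   0 ~= 1, so the zero ring is included. *)

definition units_of_ring :: "'a::{ring, monoid_mult} set" where
  "units_of_ring = {u. \<exists>v. u * v = 1 \<and> v * u = 1}"

definition right_ideal :: "'a::{ring, monoid_mult} set \<Rightarrow> bool" where
  "right_ideal I \<longleftrightarrow>
     0 \<in> I \<and> (\<forall>x\<in>I. \<forall>y\<in>I. x - y \<in> I) \<and> (\<forall>x\<in>I. \<forall>r. x * r \<in> I)"

definition maximal_right_ideal :: "'a::{ring, monoid_mult} set \<Rightarrow> bool" where
  "maximal_right_ideal M \<longleftrightarrow>
     right_ideal M \<and> M \<noteq> UNIV \<and>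
     (\<forall>I. right_ideal I \<and> M \<subseteq> I \<longrightarrow> I = M \<or> I = UNIV)"

(* The empty intersection is UNIV, so the zero ring is its own radical. *)
definition jacobson_radical :: "'a::{ring, monoid_mult} set" where
  "jacobson_radical = \<Inter> {M. maximal_right_ideal M}"

definition Delta :: "'a::{ring, monoid_mult} set" where
  "Delta = {r. \<forall>u\<in>units_of_ring. r + u \<in> units_of_ring}"

(* The ring properties below depend only on the type 'a, which is passed as an itself
   argument and supplied as TYPE('a). *)

definition WDeltaU_ring :: "'a::{ring, monoid_mult} itself \<Rightarrow> bool" where
  "WDeltaU_ring _ \<longleftrightarrow>
     (units_of_ring :: 'a set) = {1 + d | d. d \<in> Delta} \<union> {- 1 + d | d. d \<in> Delta}"

definition WUJ_ring :: "'a::{ring, monoid_mult} itself \<Rightarrow> bool" where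
  "WUJ_ring _ \<longleftrightarrow>
     (units_of_ring :: 'a set) =
       {1 + j | j. j \<in> jacobson_radical} \<union> {- 1 + j | j. j \<in> jacobson_radical}"

definition exchange_ring :: "'a::{ring, monoid_mult} itself \<Rightarrow> bool" where
  "exchange_ring _ \<longleftrightarrow>
     (\<forall>a::'a. \<exists>e. e * e = e \<and> (\<exists>r. e = a * r) \<and> (\<exists>s. 1 - e = (1 - a) * s))"

end

theory Submission
  imports Defs
begin

text \<open>
  Since \<open>J(R) \<subseteq> \<Delta>(R)\<close> holds in every ring, everything reduces to \<open>\<Delta>(R) \<subseteq> J(R)\<close> for an exchange
  \<open>W\<Delta>U\<close> ring, and by the exchange property this follows once \<open>dR\<close> contains no nonzero idempotent
  for \<open>d \<in> \<Delta>(R)\<close>.  In a \<open>W\<Delta>U\<close> ring all square-zero elements lie in \<open>\<Delta>(R)\<close>; hence the ring is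
  Dedekind finite, and the off-diagonal Peirce components of every element with respect to an
  idempotent \<open>e\<close> lie in \<open>\<Delta>(R)\<close>.  If \<open>e = db\<close>, then modulo \<open>\<Delta>(R)\<close> the product \<open>(ede)(ebe)\<close> is \<open>e\<close>,
  so \<open>ede + (1 - e)\<close> is a unit; subtracting from it the diagonal part of \<open>d\<close>, an element of \<open>\<Delta>(R)\<close>,
  leaves a unit annihilated by \<open>e\<close>.
\<close>

section \<open>Units and \<open>\<Delta>\<close>\<close>

lemma unit_iff_right_left_inverse:
  fixes x :: "'a::{ring, monoid_mult}"
  shows "x \<in> units_of_ring \<longleftrightarrow> (\<exists>y. x * y = 1) \<and> (\<exists>z. z * x = 1)"
proof
  assume "(\<exists>y. x * y = 1) \<and> (\<exists>z. z * x = 1)"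
  then obtain y z where y: "x * y = 1" and z: "z * x = 1" by blast
  have "z = z * (x * y)" using y by simp
  also have "\<dots> = y" using z by (simp flip: mult.assoc)
  finally show "x \<in> units_of_ring" using y z by (auto simp: units_of_ring_def)
qed (auto simp: units_of_ring_def)

lemma unit_one: "(1 :: 'a::{ring, monoid_mult}) \<in> units_of_ring"
  by (auto simp: units_of_ring_def intro!: exI[of _ 1])

lemma unit_minus:
  fixes u :: "'a::{ring, monoid_mult}"
  assumes "u \<in> units_of_ring"
  shows "- u \<in> units_of_ring"
proof -
  obtain v where "u * v = 1" "v * u = 1" using assms by (auto simp: units_of_ring_def)
  then have "- u * - v = 1 \<and> - v * - u = 1" by simp
  then show ?thesis unfolding units_of_ring_def by blast
qed

lemma unit_mult:
  fixes u v :: "'a::{ring, monoid_mult}"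
  assumes "u \<in> units_of_ring" "v \<in> units_of_ring"
  shows "u * v \<in> units_of_ring"
proof -
  obtain u' v' where *: "u * u' = 1" "u' * u = 1" "v * v' = 1" "v' * v = 1"
    using assms by (auto simp: units_of_ring_def)
  have "u * v * (v' * u') = u * (v * v') * u'" by (simp only: mult.assoc)
  moreover have "v' * u' * (u * v) = v' * (u' * u) * v" by (simp only: mult.assoc)
  ultimately have "u * v * (v' * u') = 1 \<and> v' * u' * (u * v) = 1" using * by simp
  then show ?thesis unfolding units_of_ring_def by blast
qed

text \<open>A right inverse of \<open>x\<close> comes from \<open>x * y\<close> and a left inverse
  from \<open>y * x\<close>.\<close>

lemma unit_factor:
  fixes x y :: "'a::{ring, monoid_mult}"
  assumes "x * y \<in> units_of_ring" "y * x \<in> units_of_ring"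
  shows "x \<in> units_of_ring"
proof -
  obtain p q where "x * y * p = 1" "q * (y * x) = 1"
    using assms by (auto simp: units_of_ring_def)
  then have "x * (y * p) = 1" "(q * y) * x = 1" by (simp_all add: mult.assoc)
  then show ?thesis unfolding unit_iff_right_left_inverse by blast
qed

lemma Delta_add:
  fixes r s :: "'a::{ring, monoid_mult}"
  assumes "r \<in> Delta" "s \<in> Delta"
  shows "r + s \<in> Delta"
  using assms by (simp add: Delta_def add.assoc)

lemma Delta_minus:
  fixes r :: "'a::{ring, monoid_mult}"
  assumes "r \<in> Delta"
  shows "- r \<in> Delta"
  unfolding Delta_def
proof clarify
  fix u :: 'a assume "u \<in> units_of_ring"
  then have "r + - u \<in> units_of_ring" using assms unit_minus unfolding Delta_def by blast
  then have "- (r + - u) \<in> units_of_ring" by (rule unit_minus)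
  then show "- r + u \<in> units_of_ring" by (simp add: add.commute)
qed

lemma Delta_diff:
  fixes r s :: "'a::{ring, monoid_mult}"
  assumes "r \<in> Delta" "s \<in> Delta"
  shows "r - s \<in> Delta"
  using Delta_add[OF assms(1) Delta_minus[OF assms(2)]] by simp

lemma unit_diff_Delta:
  fixes u r :: "'a::{ring, monoid_mult}"
  assumes "u \<in> units_of_ring" "r \<in> Delta"
  shows "u - r \<in> units_of_ring"
  using Delta_minus[OF assms(2)] assms(1) by (auto simp: Delta_def)

text \<open>Factor out the unit: ur + v = u(r + u^{-1}v), a product of two units.\<close>

lemma Delta_unit_mult:
  fixes u r :: "'a::{ring, monoid_mult}"
  assumes u: "u \<in> units_of_ring" and r: "r \<in> Delta"
  shows "u * r \<in> Delta"
  unfolding Delta_def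
proof clarify
  fix v :: 'a assume v: "v \<in> units_of_ring"
  obtain u' where u': "u * u' = 1" "u' * u = 1" using u by (auto simp: units_of_ring_def)
  then have "u' \<in> units_of_ring" unfolding units_of_ring_def by blast
  then have "u * (r + u' * v) \<in> units_of_ring"
    using r u v unit_mult unfolding Delta_def by blast
  moreover have "u * (r + u' * v) = u * r + v"
    using u' by (simp add: distrib_left flip: mult.assoc)
  ultimately show "u * r + v \<in> units_of_ring" by simp
qed

text \<open>Write rs = (r + 1)s - s, where r + 1 is a unit.\<close>

lemma Delta_mult:
  fixes r s :: "'a::{ring, monoid_mult}"
  assumes "r \<in> Delta" "s \<in> Delta"
  shows "r * s \<in> Delta"
proof -
  have "(r + 1) * s \<in> Delta"
    using assms unit_one Delta_unit_mult unfolding Delta_def by blast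
  from Delta_diff[OF this assms(2)] show ?thesis by (simp add: distrib_right)
qed

text \<open>The unit 1 - g is annihilated by g from the left.\<close>

lemma idempotent_Delta_eq_0:
  fixes g :: "'a::{ring, monoid_mult}"
  assumes "g * g = g" "g \<in> Delta"
  shows "g = 0"
proof -
  obtain v where v: "(1 - g) * v = 1"
    using unit_diff_Delta[OF unit_one assms(2)] by (auto simp: units_of_ring_def)
  have "g = g * (1 - g) * v" using v by (simp add: mult.assoc)
  also have "\<dots> = 0" using assms(1) by (simp add: right_diff_distrib)
  finally show ?thesis .
qed

section \<open>Maximal right ideals and the Jacobson radical\<close>

lemma right_ideal_eq_UNIV_iff:
  fixes I :: "'a::{ring, monoid_mult} set"
  assumes "right_ideal I"
  shows "I = UNIV \<longleftrightarrow> 1 \<in> I"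
proof
  assume "1 \<in> I"
  then have "1 * r \<in> I" for r using assms unfolding right_ideal_def by blast
  then show "I = UNIV" by auto
qed auto

lemma right_ideal_principal:
  "right_ideal (range ((*) (x :: 'a::{ring, monoid_mult})))"
  unfolding right_ideal_def
proof (intro conjI ballI allI)
  show "0 \<in> range ((*) x)" by (rule range_eqI[of _ _ 0]) simp
  fix y assume "y \<in> range ((*) x)"
  then obtain s where s: "y = x * s" by blast
  show "y * r \<in> range ((*) x)" for r using s by (simp add: mult.assoc)
  fix z assume "z \<in> range ((*) x)"
  then obtain t where t: "z = x * t" by blast
  show "y - z \<in> range ((*) x)" using s t by (simp flip: right_diff_distrib)
qed

text \<open>Zorn's lemma, with properness expressed as not containing 1, a condition that passes to
  unions of chains.\<close>

lemma maximal_right_ideal_exists: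
  fixes I :: "'a::{ring, monoid_mult} set"
  assumes I: "right_ideal I" and proper: "I \<noteq> UNIV"
  obtains M where "maximal_right_ideal M" "I \<subseteq> M"
proof -
  define A where "A = {K. right_ideal K \<and> I \<subseteq> K \<and> 1 \<notin> K}"
  have "I \<in> A" using I proper right_ideal_eq_UNIV_iff unfolding A_def by blast
  have "\<exists>M\<in>A. \<forall>X\<in>A. M \<subseteq> X \<longrightarrow> X = M"
  proof (rule subset_Zorn_nonempty)
    show "A \<noteq> {}" using \<open>I \<in> A\<close> by blast
    fix C assume ne: "C \<noteq> {}" and chain: "subset.chain A C"
    have CA: "K \<in> A" if "K \<in> C" for K
      using chain that unfolding subset.chain_def by blast
    have "right_ideal (\<Union>C)"
      unfolding right_ideal_def
    proof (intro conjI ballI allI)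
      show "0 \<in> \<Union>C" using ne CA unfolding A_def right_ideal_def by blast
      fix x assume "x \<in> \<Union>C"
      then obtain K where K: "K \<in> C" "x \<in> K" by blast
      show "x * r \<in> \<Union>C" for r using K CA unfolding A_def right_ideal_def by blast
      fix y assume "y \<in> \<Union>C"
      then obtain L where L: "L \<in> C" "y \<in> L" by blast
      have "K \<subseteq> L \<or> L \<subseteq> K" using chain K L unfolding subset.chain_def by blast
      then obtain P where "P \<in> C" "x \<in> P" "y \<in> P" using K L by blast
      then show "x - y \<in> \<Union>C" using CA unfolding A_def right_ideal_def by blast
    qed
    then show "\<Union>C \<in> A" using ne CA unfolding A_def by blast
  qed
  then obtain M where M: "M \<in> A" "\<And>X. X \<in> A \<Longrightarrow> M \<subseteq> X \<Longrightarrow> X = M" by blast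
  have "K = M \<or> K = UNIV" if "right_ideal K" "M \<subseteq> K" for K
    using that M right_ideal_eq_UNIV_iff[of K] unfolding A_def by blast
  then have "maximal_right_ideal M" "I \<subseteq> M"
    using M(1) unfolding A_def maximal_right_ideal_def by blast+
  then show ?thesis using that by blast
qed

lemma jacobson_mult_right:
  fixes j :: "'a::{ring, monoid_mult}"
  assumes "j \<in> jacobson_radical"
  shows "j * r \<in> jacobson_radical"
  using assms unfolding jacobson_radical_def maximal_right_ideal_def right_ideal_def
  by (simp add: Ball_def)

lemma jacobson_minus:
  fixes j :: "'a::{ring, monoid_mult}"
  assumes "j \<in> jacobson_radical"
  shows "- j \<in> jacobson_radical"
  using jacobson_mult_right[OF assms, of "- 1"] by simp

text \<open>Otherwise (1 + j)R lies in some maximal right ideal M, which also contains j and hence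
  1.\<close>

lemma jacobson_right_inverse:
  fixes j :: "'a::{ring, monoid_mult}"
  assumes "j \<in> jacobson_radical"
  shows "\<exists>s. (1 + j) * s = 1"
proof (rule ccontr)
  assume no: "\<nexists>s. (1 + j) * s = 1"
  then have "range ((*) (1 + j)) \<noteq> UNIV" by (metis rangeE UNIV_I)
  then obtain M where M: "maximal_right_ideal M" "range ((*) (1 + j)) \<subseteq> M"
    using maximal_right_ideal_exists[OF right_ideal_principal] by blast
  have R: "right_ideal M" using M(1) unfolding maximal_right_ideal_def by blast
  have "(1 + j) * 1 \<in> M" using M(2) by blast
  moreover have "j \<in> M" using assms M(1) unfolding jacobson_radical_def by blast
  ultimately have "(1 + j) - j \<in> M" using R unfolding right_ideal_def by (metis mult_1_right)
  then have "M = UNIV" using right_ideal_eq_UNIV_iff[OF R] by simp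
  then show False using M(1) unfolding maximal_right_ideal_def by blast
qed

lemma unit_one_plus_jacobson:
  fixes j :: "'a::{ring, monoid_mult}"
  assumes "j \<in> jacobson_radical"
  shows "1 + j \<in> units_of_ring"
proof -
  obtain s where s: "(1 + j) * s = 1" using jacobson_right_inverse[OF assms] by blast
  \<comment> \<open>The right inverse s is itself 1 plus a radical element, so it has a right
    inverse too. Having inverses on both sides, s is a unit, and 1 + j is its inverse.\<close>
  have "s = 1 + - (j * s)" using s by (simp add: distrib_right eq_diff_eq)
  then obtain t where t: "s * t = 1"
    using jacobson_right_inverse[OF jacobson_minus[OF jacobson_mult_right[OF assms, of s]]]
    by auto
  have "s \<in> units_of_ring" using s t unit_iff_right_left_inverse by blast
  then obtain s' where s': "s * s' = 1" "s' * s = 1" by (auto simp: units_of_ring_def)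
  have "1 + j = (1 + j) * (s * s')" using s' by simp
  also have "\<dots> = s'" using s by (simp flip: mult.assoc)
  finally show ?thesis using s' unfolding units_of_ring_def by blast
qed

lemma jacobson_subset_Delta: "(jacobson_radical :: 'a::{ring, monoid_mult} set) \<subseteq> Delta"
proof
  fix j :: 'a assume j: "j \<in> jacobson_radical"
  show "j \<in> Delta"
    unfolding Delta_def
  proof clarify
    fix u :: 'a assume u: "u \<in> units_of_ring"
    then obtain v where v: "v * u = 1" by (auto simp: units_of_ring_def)
    \<comment> \<open>With v = u^{-1}, j + u factors as (1 + jv)u, and jv stays in the
      radical.\<close>
    have "(1 + j * v) * u \<in> units_of_ring"
      using unit_mult[OF unit_one_plus_jacobson[OF jacobson_mult_right[OF j]] u] .
    moreover have "(1 + j * v) * u = j + u"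
      using v by (simp add: distrib_right mult.assoc add.commute)
    ultimately show "j + u \<in> units_of_ring" by simp
  qed
qed

section \<open>\<open>W\<Delta>U\<close> rings\<close>

text \<open>As 2 is central, u^2 - 4 = (2 + u)(u - 2) in either order, so 2 + u divides a unit on
  both sides.\<close>

lemma two_in_Delta:
  fixes two :: "'a::{ring, monoid_mult}"
  defines "two \<equiv> 1 + 1"
  assumes four: "two * two \<in> Delta"
  shows "two \<in> Delta"
  unfolding Delta_def
proof clarify
  fix u :: 'a assume u: "u \<in> units_of_ring"
  have comm: "two * u = u * two" by (simp add: two_def algebra_simps)
  have "u * u - two * two \<in> units_of_ring" using unit_diff_Delta[OF unit_mult[OF u u] four] .
  moreover have "(two + u) * (u - two) = u * u - two * two"
    "(u - two) * (two + u) = u * u - two * two"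
    using comm by (simp_all add: algebra_simps)
  ultimately show "two + u \<in> units_of_ring"
    using unit_factor[of "two + u" "u - two"] by simp
qed

text \<open>If n is not in \<Delta>, the unit 1 + n can only have the form -1 + d, so 2 + n lies in
  \<Delta>. The same holds for -n. Adding gives 4 in \<Delta>, hence 2 in \<Delta>, and so n = (2 +
  n) - 2 in \<Delta>, a contradiction.\<close>

lemma WDeltaU_square_zero:
  fixes n :: "'a::{ring, monoid_mult}"
  assumes W: "WDeltaU_ring TYPE('a)" and sq: "n * n = 0"
  shows "n \<in> Delta"
proof (rule ccontr)
  assume no: "n \<notin> Delta"
  have two: "1 + 1 + m \<in> Delta" if "m * m = 0" "m \<notin> Delta" for m :: 'a
  proof -
    have "(1 + m) * (1 - m) = 1 \<and> (1 - m) * (1 + m) = 1" using that by (simp add: algebra_simps)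
    then have "1 + m \<in> units_of_ring" unfolding units_of_ring_def by blast
    then obtain d where d: "d \<in> Delta" "1 + m = 1 + d \<or> 1 + m = - 1 + d"
      using W unfolding WDeltaU_ring_def by blast
    then have "1 + m = - 1 + d" using that by auto
    then have "1 + 1 + m = d" by (simp add: add.assoc)
    then show ?thesis using d by simp
  qed
  have "- n \<notin> Delta" using no Delta_minus[of "- n"] by auto
  then have "(1 + 1 + n) + (1 + 1 + - n) \<in> Delta"
    using sq no by (intro Delta_add two) simp_all
  moreover have "(1 + 1 + n) + (1 + 1 + - n) = (1 + 1) * (1 + 1)" by (simp add: algebra_simps)
  ultimately have "1 + 1 \<in> (Delta :: 'a set)" using two_in_Delta by simp
  from Delta_diff[OF two[OF sq no] this] no show False by simp
qed

text \<open>The defect g = 1 - ba is an idempotent with gb = 0 = ag. So bg and ga square to zero and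
  lie in \<Delta>, while their product (ga)(bg) is g itself; an idempotent in \<Delta>
  vanishes.\<close>

lemma WDeltaU_Dedekind_finite:
  fixes a b :: "'a::{ring, monoid_mult}"
  assumes W: "WDeltaU_ring TYPE('a)" and ab: "a * b = 1"
  shows "b * a = 1"
proof -
  define g where "g = 1 - b * a"
  have aba: "a * b * x = x" "a * (b * x) = x" for x using ab by (simp_all flip: mult.assoc)
  have gb: "g * b = 0" and ag: "a * g = 0" and gg: "g * g = g"
    by (simp_all add: g_def algebra_simps ab aba)
  have "(b * g) * (b * g) = b * (g * b) * g" "(g * a) * (g * a) = g * (a * g) * a"
    by (simp_all only: mult.assoc)
  then have "b * g \<in> Delta" "g * a \<in> Delta"
    using gb ag by (simp_all add: WDeltaU_square_zero[OF W])
  then have "(g * a) * (b * g) \<in> Delta" using Delta_mult by blast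
  moreover have "(g * a) * (b * g) = g" using gg aba by (simp add: mult.assoc)
  ultimately have "g = 0" using idempotent_Delta_eq_0[OF gg] by simp
  then show ?thesis by (simp add: g_def)
qed

text \<open>Both corners square to zero, since e(1 - e) = 0 = (1 - e)e.\<close>

lemma WDeltaU_offdiagonal:
  fixes e x :: "'a::{ring, monoid_mult}"
  assumes W: "WDeltaU_ring TYPE('a)" and e: "e * e = e"
  shows "e * x * (1 - e) \<in> Delta" and "(1 - e) * x * e \<in> Delta"
proof -
  define f where "f = 1 - e"
  have z: "f * e = 0" "e * f = 0" using e by (simp_all add: f_def algebra_simps)
  have "(e * x * f) * (e * x * f) = e * x * (f * e) * x * f"
    "(f * x * e) * (f * x * e) = f * x * (e * f) * x * e"
    by (simp_all only: mult.assoc)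
  then have "e * x * f \<in> Delta \<and> f * x * e \<in> Delta"
    using z by (simp add: WDeltaU_square_zero[OF W])
  then show "e * x * (1 - e) \<in> Delta" "(1 - e) * x * e \<in> Delta" by (simp_all add: f_def)
qed

lemma WDeltaU_idempotent_in_Delta_ideal:
  fixes e d b :: "'a::{ring, monoid_mult}"
  assumes W: "WDeltaU_ring TYPE('a)" and d: "d \<in> Delta" and e: "e * e = e" and eq: "e = d * b"
  shows "e = 0"
proof -
  define f where "f = 1 - e"
  have f: "f * f = f" "f * e = 0" "e * f = 0" "e + f = 1"
    using e by (simp_all add: f_def algebra_simps)
  have off: "e * x * f \<in> Delta" "f * x * e \<in> Delta" for x
    using WDeltaU_offdiagonal[OF W e] by (simp_all add: f_def)
  have assoc: "e * (e * x) = e * x" "f * (f * x) = f * x" "e * (f * x) = 0" "f * (e * x) = 0" for x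
    using e f by (simp_all flip: mult.assoc)
  \<comment> \<open>\<open>w\<close> keeps the e-corner of \<open>d\<close> and has \<open>f\<close>
    in the complementary corner; \<open>\<delta>\<close> is the error in treating ebe as a right
    inverse of ede within eRe; \<open>D\<close> is the block-diagonal part of
    \<open>d\<close>.\<close>
  define w where "w = e * d * e + f"
  define \<delta> where "\<delta> = (e * d * f) * (f * b * e)"
  define D where "D = e * d * e + f * d * f"
  have \<delta>: "\<delta> \<in> Delta" unfolding \<delta>_def using Delta_mult off by blast
  \<comment> \<open>Inserting e + f = 1 between d and b splits e = e(db)e into the corner product
    and the error term.\<close>
  have "e * d * (e + f) * b * e = e * (d * b) * e" using f by (simp add: mult.assoc)
  then have "e * d * (e + f) * b * e = e" using e by (simp flip: eq)
  moreover have "e * d * (e + f) * b * e = (e * d * e) * (e * b * e) + \<delta>"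
    by (simp only: \<delta>_def distrib_left distrib_right mult.assoc assoc)
  ultimately have split: "e = (e * d * e) * (e * b * e) + \<delta>" by simp
  have "w * (e * b * e + f) = (e * d * e) * (e * b * e) + f"
    using e f by (simp add: w_def distrib_left distrib_right mult.assoc assoc)
  also have "\<dots> = e - \<delta> + f" using split by (metis add_diff_cancel_right')
  also have "\<dots> = 1 - \<delta>" by (simp add: f_def)
  finally have "w * (e * b * e + f) = 1 - \<delta>" .
  moreover obtain y where "(1 - \<delta>) * y = 1"
    using unit_diff_Delta[OF unit_one \<delta>] by (auto simp: units_of_ring_def)
  ultimately have right: "w * ((e * b * e + f) * y) = 1" by (simp flip: mult.assoc)
  \<comment> \<open>Dedekind finiteness makes the right inverse of \<open>w\<close>
    two-sided.\<close>
  then have w: "w \<in> units_of_ring"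
    using WDeltaU_Dedekind_finite[OF W right] unfolding units_of_ring_def by blast
  \<comment> \<open>Peirce decomposition of d: \<open>D\<close> differs from it only by off-diagonal
    corners, which lie in \<Delta>.\<close>
  have "d = (e + f) * d * (e + f)" using f by simp
  then have "d = D + e * d * f + f * d * e"
    by (simp add: D_def distrib_left distrib_right add_ac)
  then have "D = d - f * d * e - e * d * f" by (metis add_diff_cancel_right')
  then have "D \<in> Delta" using Delta_diff d off by metis
  then obtain v where v: "(w - D) * v = 1"
    using unit_diff_Delta[OF w] by (auto simp: units_of_ring_def)
  \<comment> \<open>The ede terms cancel, leaving w - D = f - fdf, which e annihilates from the left
    although w - D is a unit.\<close>
  have "e * (w - D) = 0" using f by (simp add: w_def D_def right_diff_distrib mult.assoc assoc)
  then have "e * ((w - D) * v) = 0" by (simp flip: mult.assoc)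
  then show ?thesis using v by simp
qed

lemma WDeltaU_exchange_Delta_subset_jacobson:
  assumes W: "WDeltaU_ring TYPE('a::{ring, monoid_mult})" and ex: "exchange_ring TYPE('a)"
  shows "(Delta :: 'a set) \<subseteq> jacobson_radical"
  unfolding jacobson_radical_def
proof clarify
  fix d :: 'a and M :: "'a set" assume d: "d \<in> Delta" and M: "maximal_right_ideal M"
  have R: "right_ideal M" and proper: "1 \<notin> M"
    using M right_ideal_eq_UNIV_iff[of M] unfolding maximal_right_ideal_def by blast+
  \<comment> \<open>I = dR + M, so maximality of M leaves only I = M, which puts d in M, or I = R,
    which is refuted.\<close>
  define I where "I = {d * a + m | a m. m \<in> M}"
  have inI: "d * a + m \<in> I" if "m \<in> M" for a m using that unfolding I_def by blast
  have zero: "0 \<in> M" using R unfolding right_ideal_def by blast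
  have "right_ideal I"
    unfolding right_ideal_def
  proof (intro conjI ballI allI)
    show "0 \<in> I" using inI[OF zero, of 0] by simp
    fix x assume "x \<in> I"
    then obtain a m where x: "x = d * a + m" "m \<in> M" unfolding I_def by blast
    show "x * r \<in> I" for r
      using inI[of "m * r" "a * r"] x R unfolding right_ideal_def
      by (simp add: distrib_right mult.assoc)
    fix y assume "y \<in> I"
    then obtain b n where y: "y = d * b + n" "n \<in> M" unfolding I_def by blast
    show "x - y \<in> I"
      using inI[of "m - n" "a - b"] x y R unfolding right_ideal_def
      by (simp add: algebra_simps)
  qed
  moreover have "M \<subseteq> I" using inI[of _ 0] by auto
  ultimately have "I = M \<or> I = UNIV" using M unfolding maximal_right_ideal_def by blast
  then show "d \<in> M"
  proof
    assume "I = M"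
    then show ?thesis using inI[OF zero, of 1] by simp
  next
    assume "I = UNIV"
    then obtain a m where am: "1 = d * a + m" "m \<in> M" unfolding I_def by blast
    \<comment> \<open>Exchange is applied to da. The resulting idempotent lies in dR and so
      vanishes, which turns 1 - e = (1 - da)s into 1 = ms with m in M.\<close>
    obtain e r s where e: "e * e = e" "e = d * a * r" "1 - e = (1 - d * a) * s"
      using ex unfolding exchange_ring_def by blast
    have "e = 0"
      using WDeltaU_idempotent_in_Delta_ideal[OF W d e(1), of "a * r"] e(2)
      by (simp add: mult.assoc)
    moreover have "1 - d * a = m" using am(1) by (metis add_diff_cancel_left')
    ultimately have "1 = m * s" using e(3) by simp
    then show ?thesis using am(2) R proper unfolding right_ideal_def by metis
  qed
qed

theorem corollary3p9:
  assumes "exchange_ring TYPE('a::{ring, monoid_mult})"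
  shows "WDeltaU_ring TYPE('a) \<longleftrightarrow> WUJ_ring TYPE('a)"
proof
  assume W: "WDeltaU_ring TYPE('a)"
  have "(Delta :: 'a set) = jacobson_radical"
    using WDeltaU_exchange_Delta_subset_jacobson[OF W assms] jacobson_subset_Delta by blast
  then show "WUJ_ring TYPE('a)" using W unfolding WDeltaU_ring_def WUJ_ring_def by simp
next
  assume "WUJ_ring TYPE('a)"
  then have "(units_of_ring :: 'a set) \<subseteq> {1 + d | d. d \<in> Delta} \<union> {- 1 + d | d. d \<in> Delta}"
    using jacobson_subset_Delta unfolding WUJ_ring_def by blast
  \<comment> \<open>By the definition of \<Delta>, adding d to the units 1 and -1 gives
    units.\<close>
  moreover have "{1 + d | d. d \<in> Delta} \<union> {- 1 + d | d. d \<in> Delta} \<subseteq> (units_of_ring :: 'a set)"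
    using unit_one unit_minus[OF unit_one] unfolding Delta_def by (auto simp: add.commute)
  ultimately show "WDeltaU_ring TYPE('a)" unfolding WDeltaU_ring_def by blast
qed

end
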